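(* Let $\mathcal{U}$ be the first passage time of the underlying process, $\mathcal{R}$ the restart time, and $\mathcal{T}$ the first passage time under restart. Then the probability generating function $\tilde t(z)=\sum_{n\ge 0}\mathbb{P}(\mathcal{T}=n)z^n$ of $\mathcal{T}$ is given by $$\tilde t(z) = \frac{\tilde u(z) - \sum_{n=0}^\infty z^n u(n)\sum_{i=0}^n r(i)}{1 - \tilde r(z)\,(1-\mathcal{E}_{\mathcal{U}}) - \sum_{n=0}^\infty u(n)\sum_{i=0}^n z^i r(i)}$$ for every $z$ with $|z|\le 1$ at which the denominator is nonzero.
   Context: Time is discrete, $\mathbb{N}=\{0,1,2,\ldots\}$. $\mathcal{U}$ (first passage time of the underlying process) and $\mathcal{R}$ (time until the next restart) are independent random variables with values in $\mathbb{N}\cup\{\infty\}$, with $\mathbb{P}(\mathcal{U}=0)=0$ and $\mathbb{P}(\mathcal{U}=\infty)<1$. Write $u(n)=\mathbb{P}(\mathcal{U}=n)$, $r(n)=\mathbb{P}(\mathcal{R}=n)$ for $n\in\mathbb{N}$, $\tilde u(z)=\sum_{n\ge0}u(n)z^n$, $\tilde r(z)=\sum_{n\ge0}r(n)z^n$, and $\mathcal{E}_{\mathcal{U}}=\mathbb{P}(\mathcal{U}<\infty)=\sum_{n\ge 0}u(n)$. The first passage time under restart $\mathcal{T}$ is defined recursively by $\mathcal{T}=\mathcal{U}$ if $\mathcal{R}>\mathcal{U}$ and $\mathcal{T}=\mathcal{R}+\mathcal{T}^*$ if $\mathcal{R}\le\mathcal{U}$, where $\mathcal{T}^*$ is a copy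 of $\mathcal{T}$ with the same distribution, independent of $(\mathcal{U},\mathcal{R})$ (ties count as restarts). Explicitly: let $(\mathcal{U}_k,\mathcal{R}_k)_{k\ge1}$ be i.i.d. copies of $(\mathcal{U},\mathcal{R})$ and $\kappa=\inf\{k\ge1:\mathcal{R}_k>\mathcal{U}_k\}$; then $\mathcal{T}=\sum_{j<\kappa}\mathcal{R}_j+\mathcal{U}_\kappa$ if $\kappa<\infty$, and $\mathcal{T}=\infty$ if $\kappa=\infty$. *)

theory Defs
  imports "HOL-Probability.Probability"
begin

definition point_prob :: "'a measure \<Rightarrow> ('a \<Rightarrow> enat) \<Rightarrow> nat \<Rightarrow> real" where
  "point_prob M X n = \<P>(\<omega> in M. X \<omega> = enat n)"

text \<open>The value \<open>\<infinity>\<close> does not contribute, so the generating function at \<open>1\<close> is the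
  probability that \<open>X\<close> is finite.\<close>

definition prob_gen_fun :: "'a measure \<Rightarrow> ('a \<Rightarrow> enat) \<Rightarrow> complex \<Rightarrow> complex" where
  "prob_gen_fun M X z = (\<Sum>n. of_real (point_prob M X n) * z ^ n)"

text \<open>In the two definitions below, the sequences \<open>U\<close> and \<open>R\<close> are used only at indices
  \<open>k \<ge> 1\<close>. The infimum of the empty set in \<^typ>\<open>enat\<close> is \<open>\<infinity>\<close>.\<close>

definition first_success :: "(nat \<Rightarrow> 'a \<Rightarrow> enat) \<Rightarrow> (nat \<Rightarrow> 'a \<Rightarrow> enat) \<Rightarrow> 'a \<Rightarrow> enat" where
  "first_success U R \<omega> = Inf {enat k |k. 1 \<le> k \<and> R k \<omega> > U k \<omega>}"

text \<open>A round \<open>j\<close> with \<open>R j \<omega> = U j \<omega> = \<infinity>\<close> counts as a restart that never happens: the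
  sum, taken in \<^typ>\<open>enat\<close>, is then \<open>\<infinity>\<close>.\<close>

definition restarted_time :: "(nat \<Rightarrow> 'a \<Rightarrow> enat) \<Rightarrow> (nat \<Rightarrow> 'a \<Rightarrow> enat) \<Rightarrow> 'a \<Rightarrow> enat" where
  "restarted_time U R \<omega> =
     (case first_success U R \<omega> of
        enat k \<Rightarrow> (\<Sum>j\<in>{1..<k}. R j \<omega>) + U k \<omega>
      | \<infinity> \<Rightarrow> \<infinity>)"

end

theory Submission imports Defs begin

text \<open>
  Split the first round according to its outcome: \<open>a n\<close> is the probability that it succeeds at
  time \<open>n\<close>, and \<open>b n\<close> the probability that it ends in a restart at time \<open>n\<close>. The law \<open>t\<close> of the
  restarted time satisfies the renewal equation \<open>t n = a n + (\<Sum>i\<le>n. b i * t (n - i))\<close>, so the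
  generating functions satisfy \<open>T = A + B * T\<close> on the whole closed unit disc. By independence
  \<open>a n = u n * (1 - (\<Sum>i\<le>n. r i))\<close> and \<open>b n = r n * (1 - (\<Sum>i<n. u i))\<close>, and summation by parts
  brings \<open>1 - B\<close> into the stated form.
\<close>

section \<open>Paths with a prescribed number of restarts and a prescribed total time\<close>

text \<open>From round \<open>m\<close> on, the path \<open>f\<close> of pairs (passage time,
  restart time) has \<open>k\<close> restarts, then a success, and takes time \<open>n\<close> in
  all. The recursion peels off one round of finite length \<open>i \<le> n\<close>; what remains is
  a path of the same kind started at \<open>Suc m\<close>, hence the parameter
  \<open>m\<close>.\<close>

fun success_at :: "nat \<Rightarrow> nat \<Rightarrow> nat \<Rightarrow> (nat \<Rightarrow> enat \<times> enat) \<Rightarrow> bool" where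
  "success_at 0 m n f \<longleftrightarrow> fst (f m) = enat n \<and> enat n < snd (f m)"
| "success_at (Suc k) m n f \<longleftrightarrow>
     (\<exists>i\<le>n. snd (f m) = enat i \<and> enat i \<le> fst (f m) \<and> success_at k (Suc m) (n - i) f)"

text \<open>Closed form of the recursion, which links it to the definition of
  \<open>restarted_time\<close>.\<close>

lemma success_at_iff:
  "success_at k m n f \<longleftrightarrow>
     (\<forall>j\<in>{m..<m+k}. snd (f j) \<le> fst (f j)) \<and> fst (f (m + k)) < snd (f (m + k)) \<and>
     (\<Sum>j\<in>{m..<m+k}. snd (f j)) + fst (f (m + k)) = enat n"
proof (induction k arbitrary: m n)
  case 0
  then show ?case by auto
next
  case (Suc k)
  have *: "{m..<m + Suc k} = insert m {Suc m..<Suc m + k}" by auto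
  \<comment> \<open>A sum in \<open>enat\<close> is finite only if both summands are, so the length
    \<open>i\<close> of the first round can be read off from the total.\<close>
  have sum: "x + y = enat n \<longleftrightarrow> (\<exists>i\<le>n. x = enat i \<and> y = enat (n - i))" for x y
    by (cases x; cases y) auto
  show ?case
    unfolding success_at.simps Suc * using sum by (auto simp: add.assoc)
qed

text \<open>Of two different final rounds, the earlier one would be both a success and a restart.
  This makes the events for different \<open>k\<close> disjoint.\<close>

lemma success_at_unique:
  assumes "success_at k m n f" "success_at k' m n' f"
  shows "k = k'"
proof (rule ccontr)
  assume "k \<noteq> k'"
  then have "m + k \<in> {m..<m+k'} \<or> m + k' \<in> {m..<m+k}" by auto
  with assms show False unfolding success_at_iff by fastforce
qed

text \<open>A finite value forces a first successful round, and every round before it is a restart.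
  Rounds are numbered from 1, hence \<open>m = 1\<close>.\<close>

lemma restarted_time_eq_enat_iff:
  "restarted_time U R \<omega> = enat n \<longleftrightarrow> (\<exists>k. success_at k 1 n (\<lambda>j. (U j \<omega>, R j \<omega>)))"
proof -
  define S where "S = {enat k |k. 1 \<le> k \<and> R k \<omega> > U k \<omega>}"
  have fs: "first_success U R \<omega> = Inf S" unfolding first_success_def S_def ..
  have least: "Inf S = enat (Suc k)"
    if "\<forall>j\<in>{1..<1+k}. R j \<omega> \<le> U j \<omega>" "U (1 + k) \<omega> < R (1 + k) \<omega>" for k
  proof (rule antisym)
    show "Inf S \<le> enat (Suc k)" using that(2) by (intro Inf_lower) (auto simp: S_def)
    show "enat (Suc k) \<le> Inf S"
    proof (rule Inf_greatest)
      fix x assume "x \<in> S"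
      then obtain j where j: "x = enat j" "1 \<le> j" "U j \<omega> < R j \<omega>" by (auto simp: S_def)
      then have "\<not> j \<in> {1..<1+k}" using that(1) by fastforce
      with j show "enat (Suc k) \<le> x" by auto
    qed
  qed
  show ?thesis
  proof
    assume T: "restarted_time U R \<omega> = enat n"
    then obtain K where K: "Inf S = enat K"
      by (cases "Inf S") (auto simp: restarted_time_def fs)
    \<comment> \<open>An empty \<open>S\<close> would have infimum \<infinity>. A nonempty set in
      the well-order \<open>enat\<close> attains its infimum.\<close>
    then have "S \<noteq> {}" by (auto simp: Inf_enat_def split: if_splits)
    then have "Inf S \<in> S" using Inf_enat_def LeastI_ex[of "\<lambda>x. x \<in> S"] by auto
    then have KS: "1 \<le> K" "U K \<omega> < R K \<omega>" using K by (auto simp: S_def)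
    have "R j \<omega> \<le> U j \<omega>" if "j \<in> {1..<K}" for j
    proof (rule ccontr)
      assume "\<not> R j \<omega> \<le> U j \<omega>"
      then have "enat j \<in> S" using that by (auto simp: S_def)
      then have "Inf S \<le> enat j" by (rule Inf_lower)
      then show False using K that by auto
    qed
    \<comment> \<open>If round \<open>K\<close> is the first success, there are \<open>K - 1\<close>
      restarts before it.\<close>
    with KS T K show "\<exists>k. success_at k 1 n (\<lambda>j. (U j \<omega>, R j \<omega>))"
      unfolding success_at_iff by (intro exI[of _ "K - 1"]) (auto simp: restarted_time_def fs)
  next
    assume "\<exists>k. success_at k 1 n (\<lambda>j. (U j \<omega>, R j \<omega>))"
    then obtain k where k: "success_at k 1 n (\<lambda>j. (U j \<omega>, R j \<omega>))" ..
    then have "Inf S = enat (Suc k)" by (intro least) (auto simp: success_at_iff)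
    with k show "restarted_time U R \<omega> = enat n"
      by (auto simp: success_at_iff restarted_time_def fs)
  qed
qed

text \<open>Measurability on the path space itself: independence of the future rounds is applied to
  an event in the product over \<open>{Suc m..}\<close>.\<close>

lemma sets_success_at:
  assumes "{m..} \<subseteq> I"
  shows "{f \<in> space (PiM I (\<lambda>_. count_space UNIV)). success_at k m n f}
           \<in> sets (PiM I (\<lambda>_. count_space UNIV))"
  using assms
proof (induction k arbitrary: m n)
  case 0
  then have [measurable]: "(\<lambda>f. f m) \<in> measurable (PiM I (\<lambda>_. count_space UNIV)) (count_space UNIV)"
    by (intro measurable_component_singleton) auto
  show ?case by simp
next
  case (Suc k)
  then have [measurable]: "(\<lambda>f. f m) \<in> measurable (PiM I (\<lambda>_. count_space UNIV)) (count_space UNIV)"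
    by (intro measurable_component_singleton) auto
  have "{Suc m..} \<subseteq> I" using Suc.prems by auto
  note [measurable] = Suc.IH[OF this]
  show ?case unfolding success_at.simps by measurable
qed

section \<open>Path probabilities and the renewal equation\<close>

text \<open>The \<open>k\<close>-fold convolution power of \<open>b\<close>, convolved with
  \<open>a\<close>.\<close>

fun path_prob :: "(nat \<Rightarrow> real) \<Rightarrow> (nat \<Rightarrow> real) \<Rightarrow> nat \<Rightarrow> nat \<Rightarrow> real" where
  "path_prob a b 0 n = a n"
| "path_prob a b (Suc k) n = (\<Sum>i\<le>n. b i * path_prob a b k (n - i))"

text \<open>Round \<open>m\<close> is independent of all later rounds, so peeling it off contributes
  a factor \<open>b i\<close>. That the rounds have equal laws enters through \<open>a\<close> and
  \<open>b\<close> not depending on \<open>k\<close>.\<close>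

lemma (in prob_space) prob_success_at:
  fixes X :: "nat \<Rightarrow> 'a \<Rightarrow> enat \<times> enat"
  assumes indep: "indep_vars (\<lambda>_. count_space UNIV) X {l..}"
    and a: "\<And>k n. l \<le> k \<Longrightarrow> prob {\<omega>\<in>space M. fst (X k \<omega>) = enat n \<and> enat n < snd (X k \<omega>)} = a n"
    and b: "\<And>k n. l \<le> k \<Longrightarrow> prob {\<omega>\<in>space M. snd (X k \<omega>) = enat n \<and> enat n \<le> fst (X k \<omega>)} = b n"
    and "l \<le> m"
  shows "{\<omega>\<in>space M. success_at k m n (\<lambda>j. X j \<omega>)} \<in> events"
    and "prob {\<omega>\<in>space M. success_at k m n (\<lambda>j. X j \<omega>)} = path_prob a b k n"
proof -
  let ?E = "\<lambda>k m n. {\<omega>\<in>space M. success_at k m n (\<lambda>j. X j \<omega>)}"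
  let ?C = "\<lambda>_::nat. count_space (UNIV :: (enat \<times> enat) set)"
  have rv: "X j \<in> measurable M (count_space UNIV)" if "l \<le> j" for j
    using indep that unfolding indep_vars_def by auto
  have ev: "?E k m n \<in> events" if "l \<le> m" for k m n
    using that
  proof (induction k arbitrary: m n)
    case 0
    note [measurable] = rv[OF 0]
    show ?case by simp
  next
    case (Suc k)
    note [measurable] = rv[OF Suc.prems]
    have "l \<le> Suc m" using Suc.prems by simp
    note [measurable] = Suc.IH[OF this]
    show ?case unfolding success_at.simps by measurable
  qed
  from ev[OF \<open>l \<le> m\<close>] show "?E k m n \<in> events" .
  have "prob (?E k m n) = path_prob a b k n" if "l \<le> m" for k m n
    using that
  proof (induction k arbitrary: m n)
    case 0
    then show ?case using a by simp
  next
    case (Suc k)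
    note [measurable] = rv[OF Suc.prems]
    let ?B = "\<lambda>i. {\<omega>\<in>space M. snd (X m \<omega>) = enat i \<and> enat i \<le> fst (X m \<omega>)}"
    have Bev: "?B i \<in> events" for i by measurable
    have Sm: "l \<le> Suc m" using Suc.prems by simp
    have split: "?E (Suc k) m n = (\<Union>i\<in>{..n}. ?B i \<inter> ?E k (Suc m) (n - i))" by auto
    \<comment> \<open>Disjoint blocks of an independent family are independent: the present round
      and the whole future, each as a random element of a product space.\<close>
    have iv: "indep_var (PiM {m} ?C) (\<lambda>\<omega>. \<lambda>j\<in>{m}. X j \<omega>) (PiM {Suc m..} ?C) (\<lambda>\<omega>. \<lambda>j\<in>{Suc m..}. X j \<omega>)"
      using Suc.prems by (intro indep_var_restrict[OF indep]) auto
    have prod: "prob (?B i \<inter> ?E k (Suc m) q) = prob (?B i) * prob (?E k (Suc m) q)" for i q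
    proof -
      let ?S = "{f\<in>space (PiM {m} ?C). snd (f m) = enat i \<and> enat i \<le> fst (f m)}"
      let ?T = "{f\<in>space (PiM {Suc m..} ?C). success_at k (Suc m) q f}"
      have [measurable]: "(\<lambda>f. f m) \<in> measurable (PiM {m} ?C) (count_space UNIV)"
        by (intro measurable_component_singleton) auto
      have S: "?S \<in> sets (PiM {m} ?C)" by measurable
      have T: "?T \<in> sets (PiM {Suc m..} ?C)" by (rule sets_success_at) simp
      have 1: "(\<lambda>\<omega>. \<lambda>j\<in>{m}. X j \<omega>) -` ?S \<inter> space M = ?B i"
        by (auto simp: space_PiM)
      \<comment> \<open>\<open>success_at\<close> reads only coordinates from \<open>Suc m\<close>
        on, so restricting the path to them changes nothing; \<open>success_at_iff\<close> makes
        this visible.\<close>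
      have 2: "(\<lambda>\<omega>. \<lambda>j\<in>{Suc m..}. X j \<omega>) -` ?T \<inter> space M = ?E k (Suc m) q"
        by (auto simp: space_PiM success_at_iff)
      have "(\<lambda>\<omega>. (\<lambda>j\<in>{m}. X j \<omega>, \<lambda>j\<in>{Suc m..}. X j \<omega>)) -` (?S \<times> ?T) \<inter> space M
          = ?B i \<inter> ?E k (Suc m) q"
        unfolding 1[symmetric] 2[symmetric] by blast
      with indep_varD[OF iv S T] show ?thesis unfolding 1 2 by simp
    qed
    have "prob (?E (Suc k) m n) = (\<Sum>i\<le>n. prob (?B i \<inter> ?E k (Suc m) (n - i)))"
      unfolding split
    proof (rule finite_measure_finite_Union)
      show "(\<lambda>i. ?B i \<inter> ?E k (Suc m) (n - i)) ` {..n} \<subseteq> events" using Bev ev[OF Sm] by blast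
      show "disjoint_family_on (\<lambda>i. ?B i \<inter> ?E k (Suc m) (n - i)) {..n}"
        unfolding disjoint_family_on_def by auto
    qed simp
    then show ?case using b[OF Suc.prems] Suc.IH[OF Sm] by (simp add: prod)
  qed
  from this[OF \<open>l \<le> m\<close>] show "prob (?E k m n) = path_prob a b k n" .
qed

text \<open>Summing the path probabilities over \<open>k\<close> gives the law of the restarted
  time. The term \<open>k = 0\<close> is \<open>a n\<close>, and the recursion of
  \<open>path_prob\<close> turns the others into a convolution with \<open>b\<close>.\<close>

lemma (in prob_space) point_prob_restarted_time:
  assumes "indep_vars (\<lambda>_. count_space UNIV) (\<lambda>k \<omega>. (Us k \<omega>, Rs k \<omega>)) {1..}"
    and "\<And>k n. 1 \<le> k \<Longrightarrow> prob {\<omega>\<in>space M. Us k \<omega> = enat n \<and> enat n < Rs k \<omega>} = a n"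
    and "\<And>k n. 1 \<le> k \<Longrightarrow> prob {\<omega>\<in>space M. Rs k \<omega> = enat n \<and> enat n \<le> Us k \<omega>} = b n"
  shows "restarted_time Us Rs \<in> measurable M (count_space UNIV)"
    and "point_prob M (restarted_time Us Rs) n =
           a n + (\<Sum>i\<le>n. b i * point_prob M (restarted_time Us Rs) (n - i))"
proof -
  let ?T = "restarted_time Us Rs"
  let ?E = "\<lambda>n k. {\<omega>\<in>space M. success_at k 1 n (\<lambda>j. (Us j \<omega>, Rs j \<omega>))}"
  have E: "?E n k \<in> events" "prob (?E n k) = path_prob a b k n" for n k
    using prob_success_at[OF assms(1), of a b 1 k n] assms(2,3) by simp_all
  have split: "{\<omega>\<in>space M. ?T \<omega> = enat n} = (\<Union>k. ?E n k)" for n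
    unfolding restarted_time_eq_enat_iff by auto
  have sums: "(\<lambda>k. path_prob a b k n) sums point_prob M ?T n" for n
  proof -
    have "(\<lambda>k. prob (?E n k)) sums prob (\<Union>k. ?E n k)"
      using E(1) success_at_unique
      by (intro finite_measure_UNION) (auto simp: disjoint_family_on_def)
    then show ?thesis unfolding E(2) point_prob_def split .
  qed
  show "?T \<in> measurable M (count_space UNIV)"
  proof (rule measurable_count_space_eq2_countable[THEN iffD2], intro conjI ballI)
    have fin: "?T -` {enat n} \<inter> space M \<in> events" for n
    proof -
      have "?T -` {enat n} \<inter> space M = (\<Union>k. ?E n k)" unfolding split[symmetric] by auto
      then show ?thesis using E(1) by auto
    qed
    have "?T -` {\<infinity>} \<inter> space M = space M - (\<Union>n. ?T -` {enat n} \<inter> space M)"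
      by auto
    also have "\<dots> \<in> events" using fin by (intro sets.compl_sets sets.countable_UN) auto
    finally show "?T -` {x} \<inter> space M \<in> events" for x using fin by (cases x) auto
  qed auto
  \<comment> \<open>The series over \<open>k\<close> is exchanged with the finite sum over
    \<open>i\<close>; this is the contribution of the paths with at least one restart.\<close>
  have "(\<lambda>k. \<Sum>i\<le>n. b i * path_prob a b k (n - i)) sums (\<Sum>i\<le>n. b i * point_prob M ?T (n - i))"
    by (intro sums_sum sums_mult sums)
  then have "(\<lambda>k. path_prob a b (Suc k) n) sums (\<Sum>i\<le>n. b i * point_prob M ?T (n - i))"
    by simp
  then have "(\<lambda>k. path_prob a b k n) sums ((\<Sum>i\<le>n. b i * point_prob M ?T (n - i)) + a n)"
    by (subst (asm) sums_Suc_iff) simp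
  with sums show "point_prob M ?T n = a n + (\<Sum>i\<le>n. b i * point_prob M ?T (n - i))"
    by (metis sums_unique2 add.commute)
qed

section \<open>Tails and independence for random variables in \<open>enat\<close>\<close>

lemma (in prob_space) point_prob_sums:
  assumes [measurable]: "X \<in> measurable M (count_space UNIV)"
  shows "point_prob M X sums prob {\<omega>\<in>space M. X \<omega> < \<infinity>}"
proof -
  have "(\<lambda>n. prob {\<omega>\<in>space M. X \<omega> = enat n}) sums prob (\<Union>n. {\<omega>\<in>space M. X \<omega> = enat n})"
    by (intro finite_measure_UNION) (auto simp: disjoint_family_on_def)
  moreover have "(\<Union>n. {\<omega>\<in>space M. X \<omega> = enat n}) = {\<omega>\<in>space M. X \<omega> < \<infinity>}"
    by auto
  ultimately show ?thesis by (simp add: point_prob_def[abs_def])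
qed

lemma (in prob_space) prob_enat_less:
  assumes [measurable]: "X \<in> measurable M (count_space UNIV)"
  shows "prob {\<omega>\<in>space M. X \<omega> < enat n} = (\<Sum>i<n. point_prob M X i)"
proof -
  have "{\<omega>\<in>space M. X \<omega> < enat n} = (\<Union>i\<in>{..<n}. {\<omega>\<in>space M. X \<omega> = enat i})"
    by (auto elim: less_enatE)
  moreover have "prob \<dots> = (\<Sum>i<n. prob {\<omega>\<in>space M. X \<omega> = enat i})"
    by (intro finite_measure_finite_Union) (auto simp: disjoint_family_on_def)
  ultimately show ?thesis by (simp only: point_prob_def)
qed

text \<open>The tail includes the value \<infinity>, so it is obtained from the complement and not
  as a series of point probabilities.\<close>

lemma (in prob_space) prob_enat_ge:
  assumes [measurable]: "X \<in> measurable M (count_space UNIV)"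
  shows "prob {\<omega>\<in>space M. enat n \<le> X \<omega>} = 1 - (\<Sum>i<n. point_prob M X i)"
proof -
  have "{\<omega>\<in>space M. enat n \<le> X \<omega>} = space M - {\<omega>\<in>space M. X \<omega> < enat n}"
    using not_less by blast
  moreover have "{\<omega>\<in>space M. X \<omega> < enat n} \<in> events" by measurable
  ultimately show ?thesis by (simp only: prob_compl prob_enat_less[OF assms])
qed

lemma (in prob_space) prob_enat_gt:
  assumes [measurable]: "X \<in> measurable M (count_space UNIV)"
  shows "prob {\<omega>\<in>space M. enat n < X \<omega>} = 1 - (\<Sum>i\<le>n. point_prob M X i)"
  using prob_enat_ge[OF assms, of "Suc n"] by (simp add: Suc_ile_eq lessThan_Suc_atMost)

lemma (in prob_space) prob_indep_enat:
  assumes "indep_var (count_space UNIV) X (count_space UNIV) Y"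
  shows "prob {\<omega>\<in>space M. P (X \<omega>) \<and> Q (Y \<omega>)} =
           prob {\<omega>\<in>space M. P (X \<omega>)} * prob {\<omega>\<in>space M. Q (Y \<omega>)}"
proof -
  have "(\<lambda>\<omega>. (X \<omega>, Y \<omega>)) -` ({x. P x} \<times> {y. Q y}) \<inter> space M = {\<omega>\<in>space M. P (X \<omega>) \<and> Q (Y \<omega>)}"
    "X -` {x. P x} \<inter> space M = {\<omega>\<in>space M. P (X \<omega>)}"
    "Y -` {y. Q y} \<inter> space M = {\<omega>\<in>space M. Q (Y \<omega>)}"
    by auto
  then show ?thesis using indep_varD[OF assms, of "{x. P x}" "{y. Q y}"] by simp
qed

text \<open>Carries one-round probabilities from \<open>(U, R)\<close> on \<open>M\<close> to the
  copies on \<open>N\<close>.\<close>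

lemma distr_eq_imp_measure_eq:
  assumes "X \<in> measurable M K" "Y \<in> measurable N K" "distr N K Y = distr M K X"
    and "{x. P x} \<in> sets K"
  shows "measure N {\<omega>\<in>space N. P (Y \<omega>)} = measure M {\<omega>\<in>space M. P (X \<omega>)}"
proof -
  have "measure (distr N K Y) {x. P x} = measure (distr M K X) {x. P x}"
    by (simp add: assms(3))
  moreover have "Y -` {x. P x} \<inter> space N = {\<omega>\<in>space N. P (Y \<omega>)}"
    "X -` {x. P x} \<inter> space M = {\<omega>\<in>space M. P (X \<omega>)}"
    by auto
  ultimately show ?thesis
    by (simp only: measure_distr[OF assms(1,4)] measure_distr[OF assms(2,4)])
qed

section \<open>Summation by parts and convergence on the closed disc\<close>

text \<open>In the square of index pairs below \<open>N\<close>, those with \<open>i \<le> n\<close>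
  are the complement of those with \<open>n < i\<close>. The finite identity passes to the limit,
  with no rearrangement of a double series.\<close>

lemma sums_by_parts:
  fixes u c :: "nat \<Rightarrow> 'a::real_normed_field"
  assumes "u sums E" "c sums C" "(\<lambda>i. c i * (\<Sum>m<i. u m)) sums D"
  shows "(\<lambda>n. u n * (\<Sum>i=0..n. c i)) sums (E * C - D)"
proof -
  have "(\<Sum>n<N. u n * (\<Sum>i=0..n. c i)) =
      (\<Sum>n<N. u n) * (\<Sum>i<N. c i) - (\<Sum>i<N. c i * (\<Sum>m<i. u m))" for N
    by (induction N) (auto simp: algebra_simps lessThan_Suc_atMost[symmetric] atLeast0AtMost)
  then show ?thesis
    using assms unfolding sums_def by (auto intro!: tendsto_diff tendsto_mult)
qed

lemma summable_norm_of_real_mult_power: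
  fixes z :: complex
  assumes "summable f" "\<And>n. 0 \<le> f n" "norm z \<le> 1"
  shows "summable (\<lambda>n. norm (complex_of_real (f n) * z ^ n))"
proof (rule summable_comparison_test'[OF assms(1)])
  fix n
  have "f n * norm z ^ n \<le> f n * 1"
    using assms by (intro mult_left_mono power_le_one) auto
  then show "norm (norm (complex_of_real (f n) * z ^ n)) \<le> f n"
    using assms(2)[of n] by (simp add: norm_mult norm_power)
qed

section \<open>From the renewal equation to the quotient of generating functions\<close>

theorem lemma1:
  fixes M :: "'a measure" and U R :: "'a \<Rightarrow> enat"
    and N :: "'b measure" and Us Rs :: "nat \<Rightarrow> 'b \<Rightarrow> enat"
    and z :: complex
  defines "u \<equiv> \<lambda>n. complex_of_real (point_prob M U n)"
    and "r \<equiv> \<lambda>n. complex_of_real (point_prob M R n)"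
    and "\<E> \<equiv> complex_of_real (\<P>(\<omega> in M. U \<omega> < \<infinity>))"
  assumes "prob_space M"
    and "prob_space.indep_var M (count_space UNIV) U (count_space UNIV) R"
    and "\<P>(\<omega> in M. U \<omega> = 0) = 0"
    and "\<P>(\<omega> in M. U \<omega> = \<infinity>) < 1"
    and "prob_space N"
    and "prob_space.indep_vars N (\<lambda>_. count_space UNIV) (\<lambda>k \<omega>. (Us k \<omega>, Rs k \<omega>)) {1..}"
    and "\<And>k. 1 \<le> k \<Longrightarrow>
           distr N (count_space UNIV) (\<lambda>\<omega>. (Us k \<omega>, Rs k \<omega>)) =
           distr M (count_space UNIV) (\<lambda>\<omega>. (U \<omega>, R \<omega>))"
    and "norm z \<le> 1"
    and "1 - prob_gen_fun M R z * (1 - \<E>) - (\<Sum>n. u n * (\<Sum>i=0..n. z ^ i * r i)) \<noteq> 0"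
  shows "prob_gen_fun N (restarted_time Us Rs) z =
           (prob_gen_fun M U z - (\<Sum>n. z ^ n * u n * (\<Sum>i=0..n. r i))) /
           (1 - prob_gen_fun M R z * (1 - \<E>) - (\<Sum>n. u n * (\<Sum>i=0..n. z ^ i * r i)))"
proof -
  interpret M: prob_space M by fact
  interpret N: prob_space N by fact
  have UR: "U \<in> measurable M (count_space UNIV)" "R \<in> measurable M (count_space UNIV)"
    using M.indep_var_rv1 M.indep_var_rv2 assms(5) by blast+
  note [measurable] = UR
  \<comment> \<open>Since \<open>enat\<close> is countable, the product of the discrete
    sigma-algebras is the discrete one on pairs.\<close>
  have pair_M: "(\<lambda>\<omega>. (U \<omega>, R \<omega>)) \<in> measurable M (count_space UNIV)"
    using measurable_Pair[OF UR] by (simp add: pair_measure_countable)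
  have pair_N: "(\<lambda>\<omega>. (Us k \<omega>, Rs k \<omega>)) \<in> measurable N (count_space UNIV)" if "1 \<le> k" for k
    using assms(9) that unfolding N.indep_vars_def by auto
  let ?u = "point_prob M U" and ?r = "point_prob M R" and ?t = "point_prob N (restarted_time Us Rs)"
  \<comment> \<open>Ties count as restarts: success at \<open>n\<close> requires R > n, so the sum
    in \<open>a\<close> includes \<open>n\<close>; a restart at \<open>n\<close> requires only U
    \<ge> n, so the sum in \<open>b\<close> stops before \<open>n\<close>.\<close>
  define a where "a n = ?u n * (1 - (\<Sum>i\<le>n. ?r i))" for n
  define b where "b n = ?r n * (1 - (\<Sum>i<n. ?u i))" for n
  have a: "N.prob {\<omega>\<in>space N. Us k \<omega> = enat n \<and> enat n < Rs k \<omega>} = a n" if "1 \<le> k" for k n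
    using distr_eq_imp_measure_eq[OF pair_M pair_N[OF that] assms(10)[OF that],
        of "\<lambda>(x, y). x = enat n \<and> enat n < y"]
      M.prob_indep_enat[OF assms(5), of "\<lambda>x. x = enat n" "\<lambda>y. enat n < y"]
    by (simp add: a_def M.prob_enat_gt point_prob_def[of M U])
  have b: "N.prob {\<omega>\<in>space N. Rs k \<omega> = enat n \<and> enat n \<le> Us k \<omega>} = b n" if "1 \<le> k" for k n
    using distr_eq_imp_measure_eq[OF pair_M pair_N[OF that] assms(10)[OF that],
        of "\<lambda>(x, y). y = enat n \<and> enat n \<le> x"]
      M.prob_indep_enat[OF assms(5), of "\<lambda>x. enat n \<le> x" "\<lambda>y. y = enat n"]
    by (simp add: b_def M.prob_enat_ge point_prob_def[of M R] conj_commute mult.commute)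
  note T = N.point_prob_restarted_time[OF assms(9) a b]
  note sums_U = M.point_prob_sums[OF UR(1)] and sums_R = M.point_prob_sums[OF UR(2)]
  \<comment> \<open>The second factor of \<open>a n\<close> is a tail probability of
    \<open>R\<close>, hence lies between 0 and 1. The resulting majorant \<open>?u\<close> gives
    absolute convergence even for norm 1.\<close>
  have le_u: "0 \<le> a n" "a n \<le> ?u n" for n
  proof -
    have "0 \<le> 1 - (\<Sum>i\<le>n. ?r i)" by (subst M.prob_enat_gt[OF UR(2), symmetric]) simp
    then show "0 \<le> a n" by (simp add: a_def point_prob_def[of M U])
    show "a n \<le> ?u n" by (auto simp: a_def point_prob_def intro!: mult_left_le sum_nonneg)
  qed
  have le_r: "0 \<le> b n" "b n \<le> ?r n" for n
  proof -
    have "0 \<le> 1 - (\<Sum>i<n. ?u i)" by (subst M.prob_enat_ge[OF UR(1), symmetric]) simp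
    then show "0 \<le> b n" by (simp add: b_def point_prob_def[of M R])
    show "b n \<le> ?r n" by (auto simp: b_def point_prob_def intro!: mult_left_le sum_nonneg)
  qed
  have gf_summable: "summable (\<lambda>n. norm (complex_of_real (f n) * z ^ n))"
    if "\<And>n. 0 \<le> f n" "\<And>n. f n \<le> g n" "g sums s" for f g :: "nat \<Rightarrow> real" and s
  proof (rule summable_norm_of_real_mult_power)
    show "summable f"
      using that by (intro summable_comparison_test'[OF sums_summable[OF that(3)]]) auto
  qed (use that assms(11) in auto)
  have sa: "summable (\<lambda>n. norm (complex_of_real (a n) * z ^ n))"
    using le_u sums_U by (rule gf_summable)
  have sb: "summable (\<lambda>n. norm (complex_of_real (b n) * z ^ n))"
    using le_r sums_R by (rule gf_summable)
  have st: "summable (\<lambda>n. norm (complex_of_real (?t n) * z ^ n))"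
    by (rule gf_summable[OF _ _ N.point_prob_sums[OF T(1)]]) (auto simp: point_prob_def)
  have su: "summable (\<lambda>n. norm (complex_of_real (?u n) * z ^ n))"
    by (rule gf_summable[OF _ _ sums_U]) (auto simp: point_prob_def)
  have sr: "summable (\<lambda>n. norm (complex_of_real (?r n) * z ^ n))"
    by (rule gf_summable[OF _ _ sums_R]) (auto simp: point_prob_def)
  define A where "A = (\<Sum>n. complex_of_real (a n) * z ^ n)"
  define B where "B = (\<Sum>n. complex_of_real (b n) * z ^ n)"
  let ?P = "prob_gen_fun N (restarted_time Us Rs) z"
  have sumsA: "(\<lambda>n. complex_of_real (a n) * z ^ n) sums A"
    unfolding A_def by (rule summable_sums[OF summable_norm_cancel[OF sa]])
  have sumsB: "(\<lambda>n. complex_of_real (b n) * z ^ n) sums B"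
    unfolding B_def by (rule summable_sums[OF summable_norm_cancel[OF sb]])
  have sumsU: "(\<lambda>n. u n * z ^ n) sums prob_gen_fun M U z"
    unfolding u_def prob_gen_fun_def by (rule summable_sums[OF summable_norm_cancel[OF su]])
  have sumsR: "(\<lambda>n. r n * z ^ n) sums prob_gen_fun M R z"
    unfolding r_def prob_gen_fun_def by (rule summable_sums[OF summable_norm_cancel[OF sr]])
  have sumsT: "(\<lambda>n. complex_of_real (?t n) * z ^ n) sums ?P"
    unfolding prob_gen_fun_def by (rule summable_sums[OF summable_norm_cancel[OF st]])

  \<comment> \<open>The absolutely convergent series of \<open>b\<close> and \<open>?t\<close> are
    multiplied by the Cauchy product; its coefficients are the convolution in the renewal
    equation.\<close>
  have "(\<lambda>n. \<Sum>i\<le>n. (complex_of_real (b i) * z ^ i) * (complex_of_real (?t (n - i)) * z ^ (n - i)))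
      sums (B * ?P)"
    using Cauchy_product_sums[OF sb st] by (simp add: B_def prob_gen_fun_def)
  from sums_add[OF sumsA this] have "(\<lambda>n. complex_of_real (?t n) * z ^ n) sums (A + B * ?P)"
  proof (rule sums_cong[THEN iffD1, rotated])
    fix n
    have "(complex_of_real (b i) * z ^ i) * (complex_of_real (?t (n - i)) * z ^ (n - i)) =
        of_real (b i * ?t (n - i)) * z ^ n" if "i \<le> n" for i
      using that by (simp add: power_add[symmetric] mult_ac)
    then have "(\<Sum>i\<le>n. (complex_of_real (b i) * z ^ i) * (complex_of_real (?t (n - i)) * z ^ (n - i)))
        = of_real (\<Sum>i\<le>n. b i * ?t (n - i)) * z ^ n"
      unfolding of_real_sum sum_distrib_right by (intro sum.cong) auto
    then show "complex_of_real (a n) * z ^ n +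
        (\<Sum>i\<le>n. (complex_of_real (b i) * z ^ i) * (complex_of_real (?t (n - i)) * z ^ (n - i))) =
        complex_of_real (?t n) * z ^ n"
      using T(2)[of n] by (simp only: of_real_add distrib_right)
  qed
  with sumsT have renewal: "?P = A + B * ?P" by (rule sums_unique2)

  \<comment> \<open>The coefficient of z^n is \<open>u n\<close> minus \<open>a n\<close>, so the
    numerator of the claim is \<open>A\<close>.\<close>
  have "(\<lambda>n. z ^ n * u n * (\<Sum>i=0..n. r i)) sums (prob_gen_fun M U z - A)"
    using sums_diff[OF sumsU sumsA]
    by (simp add: a_def u_def r_def algebra_simps atLeast0AtMost)
  then have num: "(\<Sum>n. z ^ n * u n * (\<Sum>i=0..n. r i)) = prob_gen_fun M U z - A"
    by (rule sums_unique[symmetric])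

  \<comment> \<open>Summation by parts with c i = z^i r(i): the series over m < i has coefficients
    \<open>r i\<close> minus \<open>b i\<close> and sums to the generating function of
    \<open>R\<close> minus \<open>B\<close>. The terms containing the generating function of
    \<open>R\<close> then cancel in the denominator, leaving \<open>1 - B\<close>.\<close>
  have "u sums \<E>"
    unfolding u_def \<E>_def using sums_U by (rule sums_of_real)
  moreover have "(\<lambda>n. z ^ n * r n) sums prob_gen_fun M R z"
    using sumsR by (simp add: mult.commute)
  moreover have "(\<lambda>i. z ^ i * r i * (\<Sum>m<i. u m)) sums (prob_gen_fun M R z - B)"
    using sums_diff[OF sumsR sumsB] by (simp add: b_def u_def r_def algebra_simps)
  ultimately have "(\<lambda>n. u n * (\<Sum>i=0..n. z ^ i * r i)) sums
      (\<E> * prob_gen_fun M R z - (prob_gen_fun M R z - B))"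
    by (rule sums_by_parts)
  then have den: "1 - prob_gen_fun M R z * (1 - \<E>) - (\<Sum>n. u n * (\<Sum>i=0..n. z ^ i * r i)) = 1 - B"
    by (simp add: sums_unique[symmetric] algebra_simps)
  with assms(12) have "1 - B \<noteq> 0" by simp
  with renewal show ?thesis
    unfolding num den by (simp add: field_simps)
qed

end
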